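(* Let $S\equiv(S,\cdot,I,\lambda,\rho)$ be a partial semigroup, let $i,j\in I$, let $a\in S_{ji}$ be sandwich-regular, and let $b\in V(a)$. Let $r=|\widehat{H}_b^a/\mathscr R^a|$ and $l=|\widehat{H}_b^a/\mathscr L^a|$, and suppose $W\setminus G_W$ is an ideal of $W$. Then $$\operatorname{rank}(P^a)\geq\operatorname{rank}(W:G_W)+\max\big(r,l,\operatorname{rank}(G_W)\big),$$ with equality if $P^a$ is MI-dominated.
   Context: A partial semigroup is a 5-tuple $(S,\cdot,I,\lambda,\rho)$ consisting of a class $S$, a partial binary operation $(x,y)\mapsto x\cdot y=xy$, a class $I$, and functions $\lambda,\rho:S\to I$ such that for all $x,y,z\in S$: (1) $xy$ is defined iff $x\rho=y\lambda$; (2) if $xy$ is defined then $(xy)\lambda=x\lambda$ and $(xy)\rho=y\rho$; (3) if $xy$ and $yz$ are defined then $(xy)z=x(yz)$; (4) for all $i,j\in I$, $S_{ij}=\{x\in S: x\lambda=i,\ x\rho=j\}$ is a set. For $x\in S$, $V(x)=\{y\in S: x=xyx,\ y=yxy\}$. $\operatorname{Reg}(S)=\{x\in S: x=xyx \text{ for some } y\in S\}$; likewise for semigroups. For $a\in S_{ji}$, the sandwich semigroup is $S_{ij}^a=(S_{ij},\star_a)$, where $x\star_a y=xay$. A regular element $a\in S_{ji}$ is sandwich-regular if $aS_{ij}a\subseteq\operatorname{Reg}(S)$. Assume $a$ is sandwich-regular and $b\in V(a)$ (so $b\in S_{ij}$). Write $P^a=\operatorname{Reg}(S_{ij}^a)$,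 which is a regular subsemigroup of $S_{ij}^a$ (containing $b$), and $W=(aS_{ij}a,\circledast)$, where $u\circledast v=ubv$, i.e. $axa\circledast aya=axaya$; $W$ is a regular monoid with identity $a$ and underlying set $aP^aa$. $G_W$ is the group of units of $W$. $\mathscr R^a,\mathscr L^a$ are Green's relations of $S_{ij}^a$ (which on $P^a$ coincide with those of $P^a$). $\widehat{H}_b^a=\{y\in P^a: aya \text{ and } aba=a \text{ are } \mathscr H\text{-related in } W\}$, and $\widehat{H}_b^a/\mathscr R^a$, $\widehat{H}_b^a/\mathscr L^a$ are the quotients of this set by the restrictions of $\mathscr R^a,\mathscr L^a$. For a semigroup $T$ and $A\subseteq T$, $\langle A\rangle$ is the subsemigroup generated by $A$; $\operatorname{rank}(T)=\min\{|A|:A\subseteq T,\ \langle A\rangle=T\}$ and the relative rank is $\operatorname{rank}(T:A)=\min\{|B|:B\subseteq T,\ \langle A\cup B\rangle=T\}$ (these are cardinals, possibly infinite). An ideal of $W$ is a subset $K$ with $x\circledast k,\ k\circledast x\in K$ for all $k\in K$, $x\in W$. In a regular semigroup $T$: $u\in T$ is a mid-identity if $xuy=xy$ for all $x,y\in T$; the natural partial order is $x\preceq y$ iff $x=ey=yf$ for some idempotents $e,f\in T$; $T$ is MI-dominated if every idempotent of $T$ is $\preceq$-below some mid-identity of $T$. *)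

theory Defs
  imports "HOL-Algebra.Group"
begin

unbundle cardinal_syntax

text \<open>A semigroup is given by a carrier set \<open>T\<close> and an operation \<open>f\<close>, of which only the
  values on \<open>T\<close> matter.\<close>

text \<open>The subsemigroup generated by \<open>A\<close> consists of the nonempty products: the empty set
  generates the empty subsemigroup, and a trivial semigroup has rank one.\<close>

inductive_set sg_generate :: "('a \<Rightarrow> 'a \<Rightarrow> 'a) \<Rightarrow> 'a set \<Rightarrow> 'a set"
  for f :: "'a \<Rightarrow> 'a \<Rightarrow> 'a" and A :: "'a set"
  where
    base: "x \<in> A \<Longrightarrow> x \<in> sg_generate f A"
  | prod: "x \<in> sg_generate f A \<Longrightarrow> y \<in> sg_generate f A \<Longrightarrow> f x y \<in> sg_generate f A"

text \<open>Ranks may be infinite, so they are cardinals in the sense of the well-order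
  representation of the library, compared by \<open>\<le>o\<close> and \<open>=o\<close>.\<close>

definition min_card :: "'a set set \<Rightarrow> 'a rel" where
  "min_card F = |SOME A. A \<in> F \<and> (\<forall>B\<in>F. |A| \<le>o |B| )|"

lemma min_card_attained:
  assumes "F \<noteq> {}"
  shows "\<exists>A\<in>F. min_card F = |A| \<and> (\<forall>B\<in>F. |A| \<le>o |B| )"
proof -
  have "\<exists>r\<in>card_of ` F. \<forall>r'\<in>card_of ` F. r \<le>o r'"
    using assms by (intro exists_minim_Card_order) (auto simp: card_of_Card_order)
  then have "\<exists>A. A \<in> F \<and> (\<forall>B\<in>F. |A| \<le>o |B| )"
    by auto
  from someI_ex[OF this] show ?thesis
    unfolding min_card_def by blast
qed

definition sg_rank :: "'a set \<Rightarrow> ('a \<Rightarrow> 'a \<Rightarrow> 'a) \<Rightarrow> 'a rel" where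
  "sg_rank T f = min_card {A. A \<subseteq> T \<and> sg_generate f A = T}"

definition sg_relrank :: "'a set \<Rightarrow> ('a \<Rightarrow> 'a \<Rightarrow> 'a) \<Rightarrow> 'a set \<Rightarrow> 'a rel" where
  "sg_relrank T f A = min_card {B. B \<subseteq> T \<and> sg_generate f (A \<union> B) = T}"

text \<open>The maximum of two cardinals over possibly different types. Adding \<open>czero\<close> only injects
  the larger one into the sum type.\<close>

definition card_max :: "'a rel \<Rightarrow> 'b rel \<Rightarrow> ('a + 'b) rel" where
  "card_max r s = (if r \<le>o s then (czero :: 'a rel) +c s else r +c (czero :: 'b rel))"

definition sg_Reg :: "'a set \<Rightarrow> ('a \<Rightarrow> 'a \<Rightarrow> 'a) \<Rightarrow> 'a set" where
  "sg_Reg T f = {x \<in> T. \<exists>y\<in>T. x = f (f x y) x}"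

definition sg_ideal :: "'a set \<Rightarrow> ('a \<Rightarrow> 'a \<Rightarrow> 'a) \<Rightarrow> 'a set \<Rightarrow> bool" where
  "sg_ideal T f K \<longleftrightarrow> K \<subseteq> T \<and> (\<forall>k\<in>K. \<forall>x\<in>T. f x k \<in> K \<and> f k x \<in> K)"

definition green_R :: "'a set \<Rightarrow> ('a \<Rightarrow> 'a \<Rightarrow> 'a) \<Rightarrow> 'a rel" where
  "green_R T f =
    {(x, y). x \<in> T \<and> y \<in> T \<and> insert x ((\<lambda>t. f x t) ` T) = insert y ((\<lambda>t. f y t) ` T)}"

definition green_L :: "'a set \<Rightarrow> ('a \<Rightarrow> 'a \<Rightarrow> 'a) \<Rightarrow> 'a rel" where
  "green_L T f =
    {(x, y). x \<in> T \<and> y \<in> T \<and> insert x ((\<lambda>t. f t x) ` T) = insert y ((\<lambda>t. f t y) ` T)}"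

definition green_H :: "'a set \<Rightarrow> ('a \<Rightarrow> 'a \<Rightarrow> 'a) \<Rightarrow> 'a rel" where
  "green_H T f = green_R T f \<inter> green_L T f"

definition sg_idempotents :: "'a set \<Rightarrow> ('a \<Rightarrow> 'a \<Rightarrow> 'a) \<Rightarrow> 'a set" where
  "sg_idempotents T f = {e \<in> T. f e e = e}"

definition mid_identities :: "'a set \<Rightarrow> ('a \<Rightarrow> 'a \<Rightarrow> 'a) \<Rightarrow> 'a set" where
  "mid_identities T f = {u \<in> T. \<forall>x\<in>T. \<forall>y\<in>T. f (f x u) y = f x y}"

definition natural_le :: "'a set \<Rightarrow> ('a \<Rightarrow> 'a \<Rightarrow> 'a) \<Rightarrow> 'a \<Rightarrow> 'a \<Rightarrow> bool" where
  "natural_le T f x y \<longleftrightarrow> x \<in> T \<and> y \<in> T \<and>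
    (\<exists>e\<in>sg_idempotents T f. \<exists>e'\<in>sg_idempotents T f. x = f e y \<and> x = f y e')"

definition MI_dominated :: "'a set \<Rightarrow> ('a \<Rightarrow> 'a \<Rightarrow> 'a) \<Rightarrow> bool" where
  "MI_dominated T f \<longleftrightarrow>
    (\<forall>e\<in>sg_idempotents T f. \<exists>u\<in>mid_identities T f. natural_le T f e u)"

record ('a, 'i) partial_semigroup_data = "'a partial_object" +
  objects :: "'i set"
  pmult :: "'a \<Rightarrow> 'a \<Rightarrow> 'a option"
  lam :: "'a \<Rightarrow> 'i"
  rho :: "'a \<Rightarrow> 'i"

text \<open>The value \<open>None\<close> means that the product is undefined. That each \<open>S\<^sub>i\<^sub>j\<close> is a set
  holds automatically.\<close>

locale partial_semigroup =
  fixes S :: "('a, 'i) partial_semigroup_data"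
  assumes lam_closed: "x \<in> carrier S \<Longrightarrow> lam S x \<in> objects S"
    and rho_closed: "x \<in> carrier S \<Longrightarrow> rho S x \<in> objects S"
    and pmult_closed:
      "\<lbrakk>x \<in> carrier S; y \<in> carrier S; pmult S x y = Some z\<rbrakk> \<Longrightarrow> z \<in> carrier S"
    and pmult_defined_iff:
      "\<lbrakk>x \<in> carrier S; y \<in> carrier S\<rbrakk> \<Longrightarrow> pmult S x y \<noteq> None \<longleftrightarrow> rho S x = lam S y"
    and lam_rho_pmult:
      "\<lbrakk>x \<in> carrier S; y \<in> carrier S; pmult S x y = Some z\<rbrakk>
        \<Longrightarrow> lam S z = lam S x \<and> rho S z = rho S y"
    and pmult_assoc:
      "\<lbrakk>x \<in> carrier S; y \<in> carrier S; z \<in> carrier S; pmult S x y = Some u; pmult S y z = Some v\<rbrakk>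
        \<Longrightarrow> pmult S u z = pmult S x v"

definition hom_set :: "('a, 'i) partial_semigroup_data \<Rightarrow> 'i \<Rightarrow> 'i \<Rightarrow> 'a set" where
  "hom_set S i j = {x \<in> carrier S. lam S x = i \<and> rho S x = j}"

definition pmult3 :: "('a, 'i) partial_semigroup_data \<Rightarrow> 'a \<Rightarrow> 'a \<Rightarrow> 'a \<Rightarrow> 'a option" where
  "pmult3 S x y z = Option.bind (pmult S x y) (\<lambda>u. pmult S u z)"

definition ps_V :: "('a, 'i) partial_semigroup_data \<Rightarrow> 'a \<Rightarrow> 'a set" where
  "ps_V S x = {y \<in> carrier S. pmult3 S x y x = Some x \<and> pmult3 S y x y = Some y}"

definition ps_Reg :: "('a, 'i) partial_semigroup_data \<Rightarrow> 'a set" where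
  "ps_Reg S = {x \<in> carrier S. \<exists>y\<in>carrier S. pmult3 S x y x = Some x}"

text \<open>The sandwich semigroup of \<open>a \<in> S\<^sub>j\<^sub>i\<close> has carrier \<open>S\<^sub>i\<^sub>j\<close>. All triple products below to
  which \<open>the\<close> is applied are defined whenever \<open>a \<in> S\<^sub>j\<^sub>i\<close> and \<open>b \<in> S\<^sub>i\<^sub>j\<close>.\<close>

definition sandwich_mult :: "('a, 'i) partial_semigroup_data \<Rightarrow> 'a \<Rightarrow> 'a \<Rightarrow> 'a \<Rightarrow> 'a" where
  "sandwich_mult S a x y = the (pmult3 S x a y)"

definition sandwich_image :: "('a, 'i) partial_semigroup_data \<Rightarrow> 'i \<Rightarrow> 'i \<Rightarrow> 'a \<Rightarrow> 'a set" where
  "sandwich_image S i j a = (\<lambda>x. the (pmult3 S a x a)) ` hom_set S i j"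

definition sandwich_regular ::
  "('a, 'i) partial_semigroup_data \<Rightarrow> 'i \<Rightarrow> 'i \<Rightarrow> 'a \<Rightarrow> bool" where
  "sandwich_regular S i j a \<longleftrightarrow>
    a \<in> hom_set S j i \<and> a \<in> ps_Reg S \<and> sandwich_image S i j a \<subseteq> ps_Reg S"

text \<open>\<open>P\<^sup>a\<close>, with operation \<^term>\<open>sandwich_mult S a\<close>.\<close>

definition sandwich_P :: "('a, 'i) partial_semigroup_data \<Rightarrow> 'i \<Rightarrow> 'i \<Rightarrow> 'a \<Rightarrow> 'a set" where
  "sandwich_P S i j a = sg_Reg (hom_set S i j) (sandwich_mult S a)"

text \<open>The monoid \<open>W = (a S\<^sub>i\<^sub>j a, \<circledast>)\<close> with \<open>u \<circledast> v = u b v\<close> and identity \<open>a\<close>.\<close>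

definition sandwich_W ::
  "('a, 'i) partial_semigroup_data \<Rightarrow> 'i \<Rightarrow> 'i \<Rightarrow> 'a \<Rightarrow> 'a \<Rightarrow> 'a monoid" where
  "sandwich_W S i j a b =
    \<lparr>carrier = sandwich_image S i j a, mult = sandwich_mult S b, one = a\<rparr>"

definition H_hat ::
  "('a, 'i) partial_semigroup_data \<Rightarrow> 'i \<Rightarrow> 'i \<Rightarrow> 'a \<Rightarrow> 'a \<Rightarrow> 'a set" where
  "H_hat S i j a b = {y \<in> sandwich_P S i j a.
    (the (pmult3 S a y a), the (pmult3 S a b a))
      \<in> green_H (carrier (sandwich_W S i j a b)) (mult (sandwich_W S i j a b))}"

definition H_hat_mod_R ::
  "('a, 'i) partial_semigroup_data \<Rightarrow> 'i \<Rightarrow> 'i \<Rightarrow> 'a \<Rightarrow> 'a \<Rightarrow> 'a set set" where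
  "H_hat_mod_R S i j a b = H_hat S i j a b //
    Restr (green_R (hom_set S i j) (sandwich_mult S a)) (H_hat S i j a b)"

definition H_hat_mod_L ::
  "('a, 'i) partial_semigroup_data \<Rightarrow> 'i \<Rightarrow> 'i \<Rightarrow> 'a \<Rightarrow> 'a \<Rightarrow> 'a set set" where
  "H_hat_mod_L S i j a b = H_hat S i j a b //
    Restr (green_L (hom_set S i j) (sandwich_mult S a)) (H_hat S i j a b)"

end

theory Submission
  imports Defs
begin

text \<open>
  The map \<open>\<phi> x = axa\<close> is a surjective homomorphism from \<open>P\<close> to \<open>W\<close>, split by
  \<open>\<psi> w = bwb\<close>, and \<open>c\<close> and \<open>\<psi> (\<phi> c)\<close> are indistinguishable between two other factors. The
  preimage \<open>H\<close> of the group of units is therefore a rectangular group: an element of \<open>H\<close> is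
  determined by its \<open>\<R>\<close>-class, its \<open>\<L>\<close>-class and its image under \<open>\<phi>\<close>, and all such triples
  occur. Hence \<open>H\<close> has rank \<open>max (r, l, rank G)\<close>: generators must meet all \<open>\<R>\<close>- and
  \<open>\<L>\<close>-classes and map to generators of \<open>G\<close>, and conversely one family of this size can run
  through all \<open>\<R>\<close>-classes, all \<open>\<L>\<close>-classes and all generators of \<open>G\<close> at once.
  As \<open>P - H\<close> is an ideal, a generating set of \<open>P\<close> splits into one of \<open>H\<close> and a rest whose
  image generates \<open>W\<close> together with \<open>G\<close>. Under MI-domination
  \<open>P = H \<psi>(W) H\<close>, so generators of \<open>H\<close> and lifts of relative generators of \<open>W\<close> generate \<open>P\<close>.
\<close>

section \<open>Generation and rank\<close>

lemma sg_generate_mono: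
  assumes "A \<subseteq> B"
  shows "sg_generate f A \<subseteq> sg_generate f B"
proof
  fix x assume "x \<in> sg_generate f A"
  then show "x \<in> sg_generate f B"
    by induction (use assms in \<open>auto intro: sg_generate.intros\<close>)
qed

lemma sg_generate_subset:
  assumes "A \<subseteq> T" and "\<And>x y. x \<in> T \<Longrightarrow> y \<in> T \<Longrightarrow> f x y \<in> T"
  shows "sg_generate f A \<subseteq> T"
proof
  fix x assume "x \<in> sg_generate f A"
  then show "x \<in> T" by induction (use assms in auto)
qed

lemma sg_generate_closed:
  assumes "\<And>x y. x \<in> T \<Longrightarrow> y \<in> T \<Longrightarrow> f x y \<in> T"
  shows "sg_generate f T = T"
  using sg_generate_subset[OF subset_refl, of T f] assms by (auto intro: sg_generate.base)

lemma sg_generate_image: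
  assumes "A \<subseteq> T" and "\<And>x y. x \<in> T \<Longrightarrow> y \<in> T \<Longrightarrow> f x y \<in> T"
    and hom: "\<And>x y. x \<in> T \<Longrightarrow> y \<in> T \<Longrightarrow> h (f x y) = g (h x) (h y)"
  shows "sg_generate g (h ` A) = h ` sg_generate f A"
proof (intro equalityI subsetI)
  have sub: "sg_generate f A \<subseteq> T" using sg_generate_subset[of A T f] assms(1,2) by blast
  fix x assume "x \<in> sg_generate g (h ` A)"
  then show "x \<in> h ` sg_generate f A"
  proof induction
    case (base x)
    then show ?case by (auto intro: sg_generate.base)
  next
    case (prod x y)
    then obtain x' y' where "x' \<in> sg_generate f A" "x = h x'" "y' \<in> sg_generate f A" "y = h y'"
      by auto
    moreover from this have "h (f x' y') = g x y" using sub hom[of x' y'] by auto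
    ultimately show ?case
      by (intro rev_image_eqI[of "f x' y'"]) (auto intro: sg_generate.prod)
  qed
next
  have sub: "sg_generate f A \<subseteq> T" using sg_generate_subset[of A T f] assms(1,2) by blast
  fix x assume "x \<in> h ` sg_generate f A"
  then obtain x' where x': "x' \<in> sg_generate f A" "x = h x'" by auto
  from x'(1) have "h x' \<in> sg_generate g (h ` A)"
  proof induction
    case (base x)
    then show ?case by (auto intro: sg_generate.base)
  next
    case (prod x y)
    then have "h (f x y) = g (h x) (h y)" using sub hom[of x y] by auto
    then show ?case using prod.IH by (auto intro: sg_generate.prod)
  qed
  then show "x \<in> sg_generate g (h ` A)" using x' by simp
qed

lemma sg_generate_eq_empty:
  assumes "sg_generate f A = T" and "A = {}"
  shows "T = {}"
proof -
  have "x \<in> sg_generate f A \<Longrightarrow> False" for x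
    by (induction rule: sg_generate.induct) (use assms in auto)
  then show ?thesis using assms(1) by auto
qed

section \<open>Ranks as attained minima\<close>

lemma min_card_le: "A \<in> F \<Longrightarrow> min_card F \<le>o |A|"
  using min_card_attained[of F] by fastforce

lemma sg_rank_le: "A \<subseteq> T \<Longrightarrow> sg_generate f A = T \<Longrightarrow> sg_rank T f \<le>o |A|"
  unfolding sg_rank_def by (auto intro: min_card_le)

lemma sg_relrank_le:
  "B \<subseteq> T \<Longrightarrow> sg_generate f (A \<union> B) = T \<Longrightarrow> sg_relrank T f A \<le>o |B|"
  unfolding sg_relrank_def by (auto intro: min_card_le)

lemma sg_rank_attained:
  assumes "\<And>x y. x \<in> T \<Longrightarrow> y \<in> T \<Longrightarrow> f x y \<in> T"
  obtains A where "A \<subseteq> T" "sg_generate f A = T" "sg_rank T f = |A|"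
proof -
  have "T \<in> {A. A \<subseteq> T \<and> sg_generate f A = T}"
    using sg_generate_closed[of T f] assms by simp
  then show ?thesis
    using that min_card_attained[of "{A. A \<subseteq> T \<and> sg_generate f A = T}"]
    unfolding sg_rank_def by blast
qed

lemma sg_relrank_attained:
  assumes "\<And>x y. x \<in> T \<Longrightarrow> y \<in> T \<Longrightarrow> f x y \<in> T" and "A \<subseteq> T"
  obtains B where "B \<subseteq> T" "sg_generate f (A \<union> B) = T" "sg_relrank T f A = |B|"
proof -
  have "T \<in> {B. B \<subseteq> T \<and> sg_generate f (A \<union> B) = T}"
    using sg_generate_closed[of T f] assms by (simp add: Un_absorb1)
  then show ?thesis
    using that min_card_attained[of "{B. B \<subseteq> T \<and> sg_generate f (A \<union> B) = T}"]
    unfolding sg_relrank_def by blast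
qed

section \<open>Maxima of cardinals over different types\<close>

lemma czero_csum_ordIso:
  assumes "Card_order r"
  shows "(czero :: 'a rel) +c r =o r" and "r +c (czero :: 'a rel) =o r"
  using ordIso_transitive[OF ordIso_symmetric[OF card_of_Plus_empty2, of "Field r"]]
    ordIso_transitive[OF ordIso_symmetric[OF card_of_Plus_empty1, of "Field r"]]
    card_of_Field_ordIso[OF assms]
  by (auto simp: csum_def czero_def Field_card_of)

lemma card_max_upper:
  assumes "Card_order r" "Card_order s"
  shows "r \<le>o card_max r s" "s \<le>o card_max r s"
proof -
  show "s \<le>o card_max r s"
  proof (cases "r \<le>o s")
    case True
    then show ?thesis by (simp add: card_max_def ordLeq_csum2 assms)
  next
    case False
    then have "s \<le>o r"
      using ordLeq_total[of r s] assms[THEN card_order_on_well_order_on] by blast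
    then show ?thesis using False ordLeq_transitive[OF _ ordLeq_csum1[OF assms(1)]]
      by (simp add: card_max_def)
  qed
  show "r \<le>o card_max r s"
  proof (cases "r \<le>o s")
    case True
    then show ?thesis using ordLeq_transitive[OF _ ordLeq_csum2[OF assms(2)]]
      by (simp add: card_max_def)
  next
    case False
    then show ?thesis by (simp add: card_max_def ordLeq_csum1 assms)
  qed
qed

lemma card_max_least:
  assumes "Card_order r" "Card_order s" "r \<le>o t" "s \<le>o t"
  shows "card_max r s \<le>o t"
  using assms ordIso_ordLeq_trans[OF czero_csum_ordIso(1)]
    ordIso_ordLeq_trans[OF czero_csum_ordIso(2)]
  by (auto simp: card_max_def)

lemma Card_order_card_max: "Card_order (card_max r s)"
  by (simp add: card_max_def Card_order_csum)

section \<open>Green's relations and counting of classes\<close>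

lemma green_R_sym: "(x, y) \<in> green_R T f \<Longrightarrow> (y, x) \<in> green_R T f"
  and green_L_sym: "(x, y) \<in> green_L T f \<Longrightarrow> (y, x) \<in> green_L T f"
  by (simp_all add: green_R_def green_L_def)

lemma green_R_trans:
    "(x, y) \<in> green_R T f \<Longrightarrow> (y, z) \<in> green_R T f \<Longrightarrow> (x, z) \<in> green_R T f"
  and green_L_trans:
    "(x, y) \<in> green_L T f \<Longrightarrow> (y, z) \<in> green_L T f \<Longrightarrow> (x, z) \<in> green_L T f"
  by (simp_all add: green_R_def green_L_def)

text \<open>Sending an element to its class maps any set that meets every class onto the quotient.
  This turns "generators meet every class" into a lower bound on their number.\<close>

lemma card_of_quotient_le:
  assumes "equiv H r" "A \<subseteq> H" "\<And>x. x \<in> H \<Longrightarrow> \<exists>y\<in>A. (x, y) \<in> r"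
  shows "|H // r| \<le>o |A|"
proof -
  have "H // r \<subseteq> (\<lambda>y. r `` {y}) ` A"
  proof
    fix c assume "c \<in> H // r"
    then obtain x where x: "x \<in> H" "c = r `` {x}" by (rule quotientE)
    then obtain y where "y \<in> A" "(x, y) \<in> r" using assms(3) by blast
    then show "c \<in> (\<lambda>y. r `` {y}) ` A"
      using equiv_class_eq[OF assms(1)] x by blast
  qed
  then show ?thesis by (rule surj_imp_ordLeq)
qed

text \<open>The two parts are disjoint, so forgetting the tags of the sum is injective. This lets
  lower bounds for the two parts of a generating set be added.\<close>

lemma csum_Diff_Int_ordLeq: "|A - B| +c |A \<inter> B| \<le>o |A|"
proof -
  have "inj_on (case_sum id id) ((A - B) <+> (A \<inter> B))" by (auto simp: inj_on_def)
  moreover have "case_sum id id ` ((A - B) <+> (A \<inter> B)) \<subseteq> A" by auto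
  ultimately show ?thesis
    unfolding csum_def Field_card_of card_of_ordLeq[symmetric] by blast
qed

text \<open>Being \<open>\<R>\<close>-related to the identity provides a right inverse and being
  \<open>\<L>\<close>-related a left inverse, and the two coincide. Conversely, both principal
  one-sided ideals of a unit are the whole monoid.\<close>

lemma (in monoid) green_H_one_iff:
  assumes u: "u \<in> carrier G"
  shows "(u, \<one>) \<in> green_H (carrier G) (\<otimes>) \<longleftrightarrow> u \<in> Units G"
proof
  assume "(u, \<one>) \<in> green_H (carrier G) (\<otimes>)"
  then have "\<one> \<in> insert u ((\<lambda>t. u \<otimes> t) ` carrier G)" "\<one> \<in> insert u ((\<lambda>t. t \<otimes> u) ` carrier G)"
    by (simp_all add: green_H_def green_R_def green_L_def)
  then obtain s t where "s \<in> carrier G" "u \<otimes> s = \<one>" "t \<in> carrier G" "t \<otimes> u = \<one>"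
    using u by fastforce
  then show "u \<in> Units G" using u inv_unique[of t u s] by (auto simp: Units_def)
next
  assume U: "u \<in> Units G"
  have "x \<in> (\<lambda>t. u \<otimes> t) ` carrier G" "x \<in> (\<lambda>t. t \<otimes> u) ` carrier G" if "x \<in> carrier G" for x
    using U u that m_assoc[of u "inv u" x] m_assoc[of x "inv u" u]
    by (auto intro: rev_image_eqI[of "inv u \<otimes> x"] rev_image_eqI[of "x \<otimes> inv u"])
  then have "(\<lambda>t. u \<otimes> t) ` carrier G = carrier G" "(\<lambda>t. t \<otimes> u) ` carrier G = carrier G"
    using u by auto
  then show "(u, \<one>) \<in> green_H (carrier G) (\<otimes>)"
    using u by (auto simp: green_H_def green_R_def green_L_def)
qed

section \<open>Semigroups split over a regular monoid\<close>

text \<open>\<open>T\<close> stands for the whole sandwich semigroup, where Green's relations are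
  computed, and \<open>P\<close> for its regular part. The axiom \<open>psi_phi_between\<close>
  reflects that a factor \<open>c\<close> standing between two others only enters as
  \<open>aca\<close>; \<open>W_regular\<close> is the form that sandwich-regularity takes
  here.\<close>

locale split_over_monoid = W: monoid W
  for W (structure) +
  fixes T :: "'a set" and f :: "'a \<Rightarrow> 'a \<Rightarrow> 'a" (infixl \<open>\<cdot>\<close> 70) and \<phi> \<psi>
  assumes f_closed [simp]: "x \<in> T \<Longrightarrow> y \<in> T \<Longrightarrow> x \<cdot> y \<in> T"
    and f_assoc: "x \<in> T \<Longrightarrow> y \<in> T \<Longrightarrow> z \<in> T \<Longrightarrow> x \<cdot> y \<cdot> z = x \<cdot> (y \<cdot> z)"
    and phi_closed [simp]: "x \<in> T \<Longrightarrow> \<phi> x \<in> carrier W"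
    and psi_closed [simp]: "w \<in> carrier W \<Longrightarrow> \<psi> w \<in> T"
    and phi_mult: "x \<in> T \<Longrightarrow> y \<in> T \<Longrightarrow> \<phi> (x \<cdot> y) = \<phi> x \<otimes> \<phi> y"
    and psi_mult: "v \<in> carrier W \<Longrightarrow> w \<in> carrier W \<Longrightarrow> \<psi> (v \<otimes> w) = \<psi> v \<cdot> \<psi> w"
    and phi_psi [simp]: "w \<in> carrier W \<Longrightarrow> \<phi> (\<psi> w) = w"
    and psi_phi_between: "x \<in> T \<Longrightarrow> c \<in> T \<Longrightarrow> y \<in> T \<Longrightarrow> x \<cdot> \<psi> (\<phi> c) \<cdot> y = x \<cdot> c \<cdot> y"
    and W_regular: "w \<in> carrier W \<Longrightarrow> \<exists>v\<in>carrier W. w \<otimes> v \<otimes> w = w"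
begin

abbreviation P where "P \<equiv> sg_Reg T f"

definition H where "H = {x \<in> P. \<phi> x \<in> Units W}"

section \<open>The regular part of \<open>T\<close> is a subsemigroup\<close>

lemma P_T [simp]: "x \<in> P \<Longrightarrow> x \<in> T" and H_T [simp]: "x \<in> H \<Longrightarrow> x \<in> T"
  by (auto simp: sg_Reg_def H_def)

lemma H_subset: "H \<subseteq> T"
  by auto

lemma P_regular:
  assumes "x \<in> P"
  obtains x' where "x' \<in> T" "x \<cdot> x' \<cdot> x = x"
proof -
  have "\<exists>y\<in>T. x = x \<cdot> y \<cdot> x" using assms unfolding sg_Reg_def by blast
  then show thesis using that by metis
qed

text \<open>An inner factor matters only through its image under \<open>\<phi>\<close>. All later
  computations in \<open>T\<close> rest on exchanging inner factors with equal images.\<close>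

lemma between_cong:
  assumes "x \<in> T" "c \<in> T" "d \<in> T" "y \<in> T" "\<phi> c = \<phi> d"
  shows "x \<cdot> c \<cdot> y = x \<cdot> d \<cdot> y"
  using psi_phi_between[of x c y] psi_phi_between[of x d y] assms by simp

lemma P_closed:
  assumes "x \<in> P" "y \<in> P"
  shows "x \<cdot> y \<in> P"
proof -
  obtain x' y' where x': "x' \<in> T" "x \<cdot> x' \<cdot> x = x" and y': "y' \<in> T" "y \<cdot> y' \<cdot> y = y"
    using P_regular[OF assms(1)] P_regular[OF assms(2)] by metis
  have T: "x \<in> T" "y \<in> T" using assms by auto
  \<comment> \<open>This \<open>c\<close> can be inserted between \<open>x\<close> and
    \<open>y\<close> without changing \<open>xy\<close>, and it begins with \<open>x'x\<close> and
    ends with \<open>yy'\<close>. Exchanging it for \<open>c \<psi>(v) c\<close>, which has the same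
    image in \<open>W\<close>, exposes an inverse of \<open>xy\<close>.\<close>
  define c where "c = x' \<cdot> x \<cdot> y \<cdot> y'"
  have c: "c \<in> T" using T x'(1) y'(1) by (simp add: c_def)
  obtain v where v: "v \<in> carrier W" "\<phi> c \<otimes> v \<otimes> \<phi> c = \<phi> c"
    using W_regular[of "\<phi> c"] c by auto
  have xcy: "x \<cdot> c \<cdot> y = x \<cdot> y"
  proof -
    have "x \<cdot> c \<cdot> y = (x \<cdot> x' \<cdot> x) \<cdot> (y \<cdot> y' \<cdot> y)" using T x'(1) y'(1) by (simp add: c_def f_assoc)
    then show ?thesis using x' y' by simp
  qed
  have "x \<cdot> c \<cdot> y = x \<cdot> (c \<cdot> \<psi> v \<cdot> c) \<cdot> y"
    using T c v by (intro between_cong) (auto simp: phi_mult)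
  also have "\<dots> = (x \<cdot> x' \<cdot> x) \<cdot> y \<cdot> (y' \<cdot> \<psi> v \<cdot> x') \<cdot> (x \<cdot> (y \<cdot> y' \<cdot> y))"
    using T x'(1) y'(1) v by (simp add: c_def f_assoc)
  also have "\<dots> = x \<cdot> y \<cdot> (y' \<cdot> \<psi> v \<cdot> x') \<cdot> (x \<cdot> y)" using x'(2) y'(2) by simp
  finally have "x \<cdot> y = x \<cdot> y \<cdot> (y' \<cdot> \<psi> v \<cdot> x') \<cdot> (x \<cdot> y)" using xcy by simp
  moreover have "x \<cdot> y \<in> T" "y' \<cdot> \<psi> v \<cdot> x' \<in> T" using T x'(1) y'(1) v(1) by simp_all
  ultimately show ?thesis unfolding sg_Reg_def by blast
qed

lemma psi_P: "w \<in> carrier W \<Longrightarrow> \<psi> w \<in> P"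
proof -
  assume w: "w \<in> carrier W"
  then obtain v where v: "v \<in> carrier W" "w \<otimes> v \<otimes> w = w" using W_regular by blast
  then have "\<psi> w = \<psi> w \<cdot> \<psi> v \<cdot> \<psi> w" using w by (simp flip: psi_mult)
  moreover have "\<psi> w \<in> T" "\<psi> v \<in> T" using v w by simp_all
  ultimately show ?thesis unfolding sg_Reg_def by blast
qed

section \<open>The rectangular group \<open>H\<close> over the units of \<open>W\<close>\<close>

lemma psi_H: "g \<in> Units W \<Longrightarrow> \<psi> g \<in> H"
  using W.Units_closed by (simp add: H_def psi_P)

lemma H_closed: "x \<in> H \<Longrightarrow> y \<in> H \<Longrightarrow> x \<cdot> y \<in> H"
  by (auto simp: H_def P_closed phi_mult)

text \<open>In the image of \<open>xx'x = x\<close> the unit \<open>\<phi> x\<close> can be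
  cancelled on both sides, so every such \<open>x'\<close> lies over its inverse.\<close>

lemma H_inverse:
  assumes "x \<in> H"
  obtains x' where "x' \<in> T" "x \<cdot> x' \<cdot> x = x" "\<phi> x' = inv (\<phi> x)"
proof -
  obtain x' where x': "x' \<in> T" "x \<cdot> x' \<cdot> x = x"
    using P_regular[of x] assms unfolding H_def by blast
  have u: "\<phi> x \<in> Units W" and T: "x \<in> T" using assms by (auto simp: H_def)
  have "\<phi> x \<otimes> \<phi> x' \<otimes> \<phi> x = \<phi> x"
    using x' T phi_mult[of x x'] phi_mult[of "x \<cdot> x'" x] by simp
  then have "inv (\<phi> x) \<otimes> (\<phi> x \<otimes> \<phi> x' \<otimes> \<phi> x) \<otimes> inv (\<phi> x) = inv (\<phi> x) \<otimes> \<phi> x \<otimes> inv (\<phi> x)"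
    by simp
  then have "\<phi> x' = inv (\<phi> x)"
    using u T x' by (simp add: W.m_assoc flip: W.m_assoc[of "inv (\<phi> x)" "\<phi> x"])
  then show thesis using that x' by blast
qed

text \<open>Right multiplication by \<open>y\<close> can be undone: in \<open>xyz\<close> the factor
  between the outer copies of \<open>x\<close> has the same image as \<open>x'\<close>, so
  \<open>xyz = xx'x = x\<close>.\<close>

lemma H_mult_R:
  assumes "x \<in> H" "y \<in> H"
  shows "(x \<cdot> y, x) \<in> green_R T f"
proof -
  obtain x' where x': "x' \<in> T" "x \<cdot> x' \<cdot> x = x" "\<phi> x' = inv (\<phi> x)" using H_inverse assms(1) .
  have T: "x \<in> T" "y \<in> T" and u: "\<phi> x \<in> Units W" "\<phi> y \<in> Units W"
    using assms by (auto simp: H_def)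
  define z where "z = \<psi> (inv (\<phi> y)) \<cdot> x' \<cdot> x"
  have z: "z \<in> T" using T u x' by (simp add: z_def)
  have "x \<cdot> y \<cdot> z = x \<cdot> (y \<cdot> \<psi> (inv (\<phi> y)) \<cdot> x') \<cdot> x"
    using T u x'(1) by (simp add: z_def f_assoc)
  also have "\<dots> = x \<cdot> x' \<cdot> x"
    using T u x' by (intro between_cong) (auto simp: phi_mult)
  finally have xyz: "x \<cdot> y \<cdot> z = x" using x' by simp
  have "x \<cdot> t = x \<cdot> y \<cdot> (z \<cdot> t)" if "t \<in> T" for t
    using xyz T z that by (metis f_assoc f_closed)
  then have "insert x ((\<lambda>t. x \<cdot> t) ` T) \<subseteq> insert (x \<cdot> y) ((\<lambda>t. x \<cdot> y \<cdot> t) ` T)"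
    using xyz z by (auto intro: rev_image_eqI)
  moreover have "insert (x \<cdot> y) ((\<lambda>t. x \<cdot> y \<cdot> t) ` T) \<subseteq> insert x ((\<lambda>t. x \<cdot> t) ` T)"
    using T by (auto simp: f_assoc)
  ultimately show ?thesis using T by (auto simp: green_R_def)
qed

text \<open>The left-right dual: here \<open>z\<close> cancels \<open>x\<close> from the left, the
  inner factor having the same image as \<open>y'\<close>.\<close>

lemma H_mult_L:
  assumes "x \<in> H" "y \<in> H"
  shows "(x \<cdot> y, y) \<in> green_L T f"
proof -
  obtain y' where y': "y' \<in> T" "y \<cdot> y' \<cdot> y = y" "\<phi> y' = inv (\<phi> y)" using H_inverse assms(2) .
  have T: "x \<in> T" "y \<in> T" and u: "\<phi> x \<in> Units W" "\<phi> y \<in> Units W"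
    using assms by (auto simp: H_def)
  define z where "z = y \<cdot> (y' \<cdot> \<psi> (inv (\<phi> x)))"
  have z: "z \<in> T" using T u y' by (simp add: z_def)
  have "z \<cdot> (x \<cdot> y) = y \<cdot> (y' \<cdot> \<psi> (inv (\<phi> x)) \<cdot> x) \<cdot> y"
    using T u y'(1) by (simp add: z_def f_assoc)
  also have "\<dots> = y \<cdot> y' \<cdot> y"
    using T u y' by (intro between_cong) (auto simp: phi_mult W.m_assoc)
  finally have zxy: "z \<cdot> (x \<cdot> y) = y" using y' by simp
  have "t \<cdot> y = (t \<cdot> z) \<cdot> (x \<cdot> y)" if "t \<in> T" for t
    using zxy T z that by (metis f_assoc f_closed)
  then have "insert y ((\<lambda>t. t \<cdot> y) ` T) \<subseteq> insert (x \<cdot> y) ((\<lambda>t. t \<cdot> (x \<cdot> y)) ` T)"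
    using zxy z by (auto intro: rev_image_eqI)
  moreover have "insert (x \<cdot> y) ((\<lambda>t. t \<cdot> (x \<cdot> y)) ` T) \<subseteq> insert y ((\<lambda>t. t \<cdot> y) ` T)"
    using T by (auto simp: f_assoc[symmetric])
  ultimately show ?thesis using T by (auto simp: green_L_def)
qed

text \<open>The idempotent \<open>yy'\<close> is a left identity on the \<open>\<R>\<close>-class of
  \<open>y\<close>, and \<open>y'y\<close> a right identity on its \<open>\<L>\<close>-class. Hence
  \<open>x = y(y'xy')y\<close>, whose inner factor has the same image as \<open>y'\<close> when
  \<open>\<phi> x = \<phi> y\<close>.\<close>

lemma H_eqI:
  assumes H: "x \<in> H" "y \<in> H"
    and R: "(x, y) \<in> green_R T f" and L: "(x, y) \<in> green_L T f" and eq: "\<phi> x = \<phi> y"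
  shows "x = y"
proof -
  obtain y' where y': "y' \<in> T" "y \<cdot> y' \<cdot> y = y" "\<phi> y' = inv (\<phi> y)" using H_inverse H(2) .
  have T: "x \<in> T" "y \<in> T" and u: "\<phi> y \<in> Units W" using H by (auto simp: H_def)
  have "x \<in> insert y ((\<lambda>t. y \<cdot> t) ` T)" using R by (auto simp: green_R_def)
  then have l: "y \<cdot> y' \<cdot> x = x"
    using T y' by (auto simp: f_assoc[symmetric])
  have "x \<in> insert y ((\<lambda>t. t \<cdot> y) ` T)" using L by (auto simp: green_L_def)
  then have r: "x \<cdot> (y' \<cdot> y) = x"
    using T y' by (auto simp: f_assoc)
  have "x = y \<cdot> (y' \<cdot> x \<cdot> y') \<cdot> y"
    using l r T y'(1) by (simp add: f_assoc)
  also have "\<dots> = y \<cdot> y' \<cdot> y"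
    using T u y' eq by (intro between_cong) (auto simp: phi_mult)
  finally show ?thesis using y' by simp
qed

abbreviation "H_mod_R \<equiv> H // Restr (green_R T f) H"
abbreviation "H_mod_L \<equiv> H // Restr (green_L T f) H"

lemma equiv_R: "equiv H (Restr (green_R T f) H)" and equiv_L: "equiv H (Restr (green_L T f) H)"
  by (auto simp: equiv_def refl_on_def sym_on_def trans_on_def green_R_def green_L_def)

lemma Units_conj_cancel:
  assumes "p \<in> Units W" "q \<in> Units W" "g \<in> carrier W"
  shows "p \<otimes> (inv p \<otimes> g \<otimes> inv q) \<otimes> q = g"
proof -
  have "p \<otimes> (inv p \<otimes> g \<otimes> inv q) \<otimes> q = (p \<otimes> inv p) \<otimes> g \<otimes> (inv q \<otimes> q)"
    using assms W.Units_closed W.Units_inv_closed by (simp add: W.m_assoc del: W.Units_r_inv W.Units_l_inv)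
  then show ?thesis using assms by simp
qed

text \<open>A product in \<open>H\<close> inherits the \<open>\<R>\<close>-class of its first factor
  and the \<open>\<L>\<close>-class of its last. So \<open>p \<psi>(k) q\<close> has the required
  classes, and \<open>k\<close> adjusts the image to \<open>g\<close>.\<close>

lemma H_exists:
  assumes "p \<in> H" "q \<in> H" "g \<in> Units W"
  obtains z where "z \<in> H" "\<phi> z = g" "(z, p) \<in> green_R T f" "(z, q) \<in> green_L T f"
proof -
  define k where "k = inv (\<phi> p) \<otimes> g \<otimes> inv (\<phi> q)"
  have u: "\<phi> p \<in> Units W" "\<phi> q \<in> Units W" using assms by (auto simp: H_def)
  have k: "k \<in> Units W" using u assms by (simp add: k_def)
  have eq: "\<phi> p \<otimes> k \<otimes> \<phi> q = g"
    unfolding k_def using u assms(3) by (intro Units_conj_cancel) auto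
  have H: "\<psi> k \<in> H" "\<psi> k \<cdot> q \<in> H" "p \<cdot> \<psi> k \<in> H" using k assms by (auto intro: psi_H H_closed)
  show thesis
  proof
    show "p \<cdot> \<psi> k \<cdot> q \<in> H" using H assms H_closed by simp
    show "\<phi> (p \<cdot> \<psi> k \<cdot> q) = g" using eq assms k W.Units_closed by (simp add: phi_mult)
    show "(p \<cdot> \<psi> k \<cdot> q, p) \<in> green_R T f"
      using H_mult_R[OF assms(1) H(2)] assms k W.Units_closed by (simp add: f_assoc)
    show "(p \<cdot> \<psi> k \<cdot> q, q) \<in> green_L T f"
      using H_mult_L[OF H(3) assms(2)] .
  qed
qed

lemma one_H: "\<psi> \<one> \<in> H"
  by (simp add: psi_H)

lemma phi_generate:
  assumes "A \<subseteq> T" shows "sg_generate (\<otimes>) (\<phi> ` A) = \<phi> ` sg_generate f A"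
  by (rule sg_generate_image[where T = T]) (use assms in \<open>auto simp: phi_mult\<close>)

lemma phi_H: "\<phi> ` H = Units W"
  using psi_H W.Units_closed by (auto simp: H_def intro!: rev_image_eqI[of "\<psi> _"])

lemma phi_P: "\<phi> ` P = carrier W"
  using psi_P by (auto intro!: rev_image_eqI[of "\<psi> _"])

section \<open>The rank of \<open>H\<close>\<close>

abbreviation max_card where
  "max_card \<equiv> card_max |H_mod_R| (card_max |H_mod_L| (sg_rank (Units W) (\<otimes>)))"

lemma Units_rank_attained:
  obtains A where "A \<subseteq> Units W" "sg_generate (\<otimes>) A = Units W" "sg_rank (Units W) (\<otimes>) = |A|"
  using sg_rank_attained[of "Units W" "(\<otimes>)"] by auto

lemma Card_order_rank_Units: "Card_order (sg_rank (Units W) (\<otimes>))"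
  by (rule Units_rank_attained) (simp add: card_of_Card_order)

text \<open>A product is \<open>\<R>\<close>-related to its first and \<open>\<L>\<close>-related to
  its last factor, so by induction every class already contains a generator.\<close>

lemma max_card_le:
  assumes "A \<subseteq> H" "sg_generate f A = H"
  shows "max_card \<le>o |A|"
proof -
  have "\<exists>y\<in>A. (x, y) \<in> green_R T f" if "x \<in> sg_generate f A" for x
    using that
  proof induction
    case (base x)
    then show ?case using assms(1) by (intro bexI[of _ x]) (auto simp: green_R_def)
  next
    case (prod x y)
    then show ?case using H_mult_R[of x y] assms(2) green_R_trans by metis
  qed
  then have R: "|H_mod_R| \<le>o |A|"
    using assms by (intro card_of_quotient_le[OF equiv_R]) blast+
  have "\<exists>y\<in>A. (x, y) \<in> green_L T f" if "x \<in> sg_generate f A" for x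
    using that
  proof induction
    case (base x)
    then show ?case using assms(1) by (intro bexI[of _ x]) (auto simp: green_L_def)
  next
    case (prod x y)
    then show ?case using H_mult_L[of x y] assms(2) green_L_trans by metis
  qed
  then have L: "|H_mod_L| \<le>o |A|"
    using assms by (intro card_of_quotient_le[OF equiv_L]) blast+
  have "sg_generate (\<otimes>) (\<phi> ` A) = Units W"
    using phi_generate[of A] phi_H assms by (auto simp: subset_iff)
  then have "sg_rank (Units W) (\<otimes>) \<le>o |\<phi> ` A|"
    using sg_rank_le[of "\<phi> ` A" "Units W"] assms(1) phi_H by blast
  then have "sg_rank (Units W) (\<otimes>) \<le>o |A|" by (rule ordLeq_transitive[OF _ card_of_image])
  then show ?thesis
    using R L Card_order_rank_Units
    by (intro card_max_least) (auto simp: card_of_Card_order Card_order_card_max)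
qed

lemma H_generated:
  obtains A where "A \<subseteq> H" "sg_generate f A = H" "|A| \<le>o max_card"
proof -
  obtain X where X: "X \<subseteq> Units W" "sg_generate (\<otimes>) X = Units W" "sg_rank (Units W) (\<otimes>) = |X|"
    using Units_rank_attained .
  \<comment> \<open>\<open>M\<close> is an index set of exactly the desired size. It maps onto the
    \<open>\<R>\<close>-classes, the \<open>\<L>\<close>-classes and the generators
    \<open>X\<close>, with repetitions where one of these is smaller.\<close>
  define M where "M = Field max_card"
  have M: "|M| =o max_card" unfolding M_def by (rule card_of_Field_ordIso[OF Card_order_card_max])
  have co: "Card_order |H_mod_R|" "Card_order |H_mod_L|" "Card_order |X|"
    by (auto simp: card_of_Card_order)
  note co' = Card_order_card_max[of "|H_mod_L|" "|X|"]
  have "|H_mod_R| \<le>o max_card" "|H_mod_L| \<le>o max_card" "|X| \<le>o max_card"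
    unfolding X(3)
    using card_max_upper(1)[OF co(1) co']
      ordLeq_transitive[OF card_max_upper(1)[OF co(2,3)] card_max_upper(2)[OF co(1) co']]
      ordLeq_transitive[OF card_max_upper(2)[OF co(2,3)] card_max_upper(2)[OF co(1) co']]
    by simp_all
  from this[THEN ordLeq_ordIso_trans, OF ordIso_symmetric[OF M]]
  have le: "|H_mod_R| \<le>o |M|" "|H_mod_L| \<le>o |M|" "|X| \<le>o |M|" .
  \<comment> \<open>Surjections from \<open>M\<close> exist only onto nonempty sets;
    \<open>X\<close> is nonempty because it generates a semigroup containing the identity.\<close>
  have ne: "H_mod_R \<noteq> {}" "H_mod_L \<noteq> {}" "X \<noteq> {}"
    using one_H sg_generate_eq_empty[OF X(2)] by (auto simp: quotient_def)
  obtain \<alpha> \<beta> \<gamma> where ran: "\<alpha> ` M = H_mod_R" "\<beta> ` M = H_mod_L" "\<gamma> ` M = X"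
    using le card_of_ordLeq2[OF ne(1)] card_of_ordLeq2[OF ne(2)] card_of_ordLeq2[OF ne(3)] by metis
  have "\<exists>z\<in>H. \<phi> z = \<gamma> m \<and> z \<in> \<alpha> m \<and> z \<in> \<beta> m" if "m \<in> M" for m
  proof -
    have "\<alpha> m \<in> H_mod_R" using ran(1) that by blast
    then obtain p where p: "p \<in> H" "\<alpha> m = Restr (green_R T f) H `` {p}"
      by (rule quotientE)
    have "\<beta> m \<in> H_mod_L" using ran(2) that by blast
    then obtain q where q: "q \<in> H" "\<beta> m = Restr (green_L T f) H `` {q}"
      by (rule quotientE)
    have "\<gamma> m \<in> Units W" using ran(3) that X(1) by auto
    then obtain z where z: "z \<in> H" "\<phi> z = \<gamma> m" "(z, p) \<in> green_R T f" "(z, q) \<in> green_L T f"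
      using H_exists[OF p(1) q(1)] by metis
    then have "z \<in> \<alpha> m" "z \<in> \<beta> m"
      using p q green_R_sym[OF z(3)] green_L_sym[OF z(4)] by simp_all
    then show ?thesis using z(1,2) by blast
  qed
  then obtain z where z: "\<And>m. m \<in> M \<Longrightarrow> z m \<in> H \<and> \<phi> (z m) = \<gamma> m \<and> z m \<in> \<alpha> m \<and> z m \<in> \<beta> m"
    by metis
  define A where "A = z ` M"
  have A: "A \<subseteq> H" using z by (auto simp: A_def)
  have "\<phi> ` A = X" using z ran(3) by (force simp: A_def image_image)
  then have phi_gen: "\<phi> ` sg_generate f A = Units W"
    using phi_generate[OF subset_trans[OF A H_subset]] X(2) by simp
  have gen_H: "sg_generate f A \<subseteq> H" using sg_generate_subset[OF A H_closed] .
  have "x \<in> sg_generate f A" if x: "x \<in> H" for x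
  proof -
    have "Restr (green_R T f) H `` {x} \<in> \<alpha> ` M"
      unfolding ran(1) using x by (rule quotientI)
    then obtain m where m: "Restr (green_R T f) H `` {x} = \<alpha> m" "m \<in> M"
      by (rule imageE)
    have "Restr (green_L T f) H `` {x} \<in> \<beta> ` M"
      unfolding ran(2) using x by (rule quotientI)
    then obtain n where n: "Restr (green_L T f) H `` {x} = \<beta> n" "n \<in> M"
      by (rule imageE)
    have R: "(x, z m) \<in> green_R T f" and L: "(x, z n) \<in> green_L T f"
      using z[OF m(2)] z[OF n(2)] unfolding m(1)[symmetric] n(1)[symmetric] by blast+
    have zH: "z m \<in> H" "z n \<in> H" using z m n by auto
    then have u: "\<phi> (z m) \<in> Units W" "\<phi> (z n) \<in> Units W" "\<phi> x \<in> Units W"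
      using x by (auto simp: H_def)
    \<comment> \<open>The generators \<open>z m\<close> and \<open>z n\<close> supply the
      \<open>\<R>\<close>-class and \<open>\<L>\<close>-class of \<open>x\<close>. The inner factor
      \<open>y\<close> is chosen over the unit that makes the image of the whole product equal to
      \<open>\<phi> x\<close>.\<close>
    then have "inv (\<phi> (z m)) \<otimes> \<phi> x \<otimes> inv (\<phi> (z n)) \<in> \<phi> ` sg_generate f A"
      by (simp add: phi_gen)
    then obtain y where y: "y \<in> sg_generate f A" "\<phi> y = inv (\<phi> (z m)) \<otimes> \<phi> x \<otimes> inv (\<phi> (z n))"
      by auto
    have yH: "y \<in> H" using y gen_H by auto
    have "x = z m \<cdot> y \<cdot> z n"
    proof (rule H_eqI)
      show "x \<in> H" "z m \<cdot> y \<cdot> z n \<in> H" using x zH yH by (auto intro: H_closed)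
      have "(z m \<cdot> y \<cdot> z n, z m) \<in> green_R T f"
        using H_mult_R[OF zH(1) H_closed[OF yH zH(2)]] zH yH by (simp add: f_assoc)
      then show "(x, z m \<cdot> y \<cdot> z n) \<in> green_R T f" using R green_R_sym green_R_trans by metis
      have "(z m \<cdot> y \<cdot> z n, z n) \<in> green_L T f"
        using H_mult_L[OF H_closed[OF zH(1) yH] zH(2)] .
      then show "(x, z m \<cdot> y \<cdot> z n) \<in> green_L T f" using L green_L_sym green_L_trans by metis
      show "\<phi> x = \<phi> (z m \<cdot> y \<cdot> z n)"
        using Units_conj_cancel[OF u(1,2), of "\<phi> x"] zH yH x by (simp add: phi_mult y(2))
    qed
    moreover have "z m \<in> sg_generate f A" "z n \<in> sg_generate f A"
      using m n by (auto simp: A_def intro: sg_generate.base)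
    ultimately show ?thesis using y(1) by (metis sg_generate.prod)
  qed
  then have "sg_generate f A = H" using gen_H by blast
  moreover have "|A| \<le>o max_card"
    unfolding A_def by (rule ordLeq_ordIso_trans[OF card_of_image M])
  ultimately show thesis using that A by blast
qed

section \<open>Lower bound: splitting a generating set of \<open>P\<close> along
  \<open>H\<close>\<close>

lemma H_generate_Int:
  assumes ideal: "sg_ideal (carrier W) (\<otimes>) (carrier W - Units W)" and A: "A \<subseteq> P"
    and "x \<in> sg_generate f A" and "x \<in> H"
  shows "x \<in> sg_generate f (A \<inter> H)"
  using assms(3,4)
proof induction
  case (base x)
  then show ?case by (auto intro: sg_generate.base)
next
  case (prod x y)
  have P: "x \<in> P" "y \<in> P"
    using prod.hyps sg_generate_subset[OF A, of f] P_closed by blast+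
  have "\<phi> x \<otimes> \<phi> y \<in> Units W"
    using prod.prems P by (simp add: H_def phi_mult)
  \<comment> \<open>If either image were a non-unit, the ideal would absorb the product; so both
    factors lie in \<open>H\<close> and the induction hypotheses apply.\<close>
  moreover have "\<phi> x \<in> carrier W" "\<phi> y \<in> carrier W" using P by auto
  ultimately have "\<phi> x \<in> Units W" "\<phi> y \<in> Units W"
    using ideal unfolding sg_ideal_def by blast+
  then show ?case using P prod.IH by (auto simp: H_def intro: sg_generate.prod)
qed

theorem rank_lower:
  assumes ideal: "sg_ideal (carrier W) (\<otimes>) (carrier W - Units W)"
  shows "sg_relrank (carrier W) (\<otimes>) (Units W) +c max_card \<le>o sg_rank P f"
proof -
  obtain A where A: "A \<subseteq> P" "sg_generate f A = P" "sg_rank P f = |A|"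
    using sg_rank_attained[OF P_closed] .
  have "sg_generate f (A \<inter> H) \<subseteq> H" using sg_generate_subset[of "A \<inter> H" H f] H_closed by blast
  then have "sg_generate f (A \<inter> H) = H"
    using H_generate_Int[OF ideal A(1)] A(2) by (auto simp: H_def)
  then have 1: "max_card \<le>o |A \<inter> H|" by (intro max_card_le) auto
  \<comment> \<open>Relative to all units, generators from \<open>H\<close> contribute nothing new,
    so only the images of \<open>A - H\<close> count towards the relative rank.\<close>
  have "\<phi> ` A \<subseteq> Units W \<union> \<phi> ` (A - H)" using A(1) by (auto simp: H_def)
  moreover have "sg_generate (\<otimes>) (\<phi> ` A) = carrier W"
    using phi_generate[of A] A phi_P by (auto simp: subset_iff)
  ultimately have "carrier W \<subseteq> sg_generate (\<otimes>) (Units W \<union> \<phi> ` (A - H))"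
    using sg_generate_mono by blast
  moreover have sub: "\<phi> ` (A - H) \<subseteq> carrier W" using A(1) by auto
  ultimately have "sg_generate (\<otimes>) (Units W \<union> \<phi> ` (A - H)) = carrier W"
    using sg_generate_subset[of "Units W \<union> \<phi> ` (A - H)" "carrier W" "(\<otimes>)"] by auto
  then have "sg_relrank (carrier W) (\<otimes>) (Units W) \<le>o |\<phi> ` (A - H)|"
    using sub by (intro sg_relrank_le)
  then have 2: "sg_relrank (carrier W) (\<otimes>) (Units W) \<le>o |A - H|"
    by (rule ordLeq_transitive[OF _ card_of_image])
  show ?thesis
    unfolding A(3) by (rule ordLeq_transitive[OF csum_mono[OF 2 1] csum_Diff_Int_ordLeq])
qed

section \<open>Upper bound under MI-domination\<close>

lemma mid_identity_H:
  assumes "u \<in> mid_identities P f"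
  shows "u \<in> H"
proof -
  have u: "u \<in> P" and "\<psi> \<one> \<cdot> u \<cdot> \<psi> \<one> = \<psi> \<one> \<cdot> \<psi> \<one>"
    using assms psi_P by (auto simp: mid_identities_def)
  then have "\<phi> (\<psi> \<one> \<cdot> u \<cdot> \<psi> \<one>) = \<phi> (\<psi> \<one> \<cdot> \<psi> \<one>)" by simp
  then have "\<phi> u = \<one>" using u by (simp add: phi_mult)
  then show ?thesis using u by (simp add: H_def)
qed

text \<open>The idempotents \<open>xx'\<close> and \<open>x'x\<close> lie below mid-identities
  \<open>u\<close> and \<open>v\<close>, so \<open>x = (xx')x(x'x)\<close> begins with
  \<open>u\<close> and ends with \<open>v\<close>. What remains is an inner factor and can be
  replaced by an element of \<open>\<psi>(W)\<close>.\<close>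

lemma MI_dominated_factor:
  assumes MI: "MI_dominated P f" and x: "x \<in> P"
  obtains u w v where "u \<in> H" "w \<in> carrier W" "v \<in> H" "x = u \<cdot> \<psi> w \<cdot> v"
proof -
  obtain x' where x': "x' \<in> T" "x \<cdot> x' \<cdot> x = x" using P_regular[OF x] .
  have T: "x \<in> T" using x by simp
  have idem: "(x \<cdot> x') \<cdot> (x \<cdot> x') = x \<cdot> x'" "(x' \<cdot> x) \<cdot> (x' \<cdot> x) = x' \<cdot> x"
    using T x' by (metis f_assoc f_closed)+
  then have "x \<cdot> x' \<in> sg_idempotents P f" "x' \<cdot> x \<in> sg_idempotents P f"
    unfolding sg_idempotents_def sg_Reg_def using T x'(1)
    by (auto intro: bexI[of _ "x \<cdot> x'"] bexI[of _ "x' \<cdot> x"])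
  then obtain u v where uv: "u \<in> mid_identities P f" "natural_le P f (x \<cdot> x') u"
    "v \<in> mid_identities P f" "natural_le P f (x' \<cdot> x) v"
    using MI unfolding MI_dominated_def by metis
  then obtain e d where ed: "e \<in> P" "x \<cdot> x' = u \<cdot> e" "d \<in> P" "x' \<cdot> x = d \<cdot> v"
    by (auto simp: natural_le_def sg_idempotents_def)
  have H: "u \<in> H" "v \<in> H" using uv mid_identity_H by auto
  have "(x \<cdot> x') \<cdot> x \<cdot> (x' \<cdot> x) = x"
    using x' T by (simp flip: f_assoc)
  then have "x = (u \<cdot> e) \<cdot> x \<cdot> (d \<cdot> v)" using ed(2,4) by simp
  also have "\<dots> = u \<cdot> (e \<cdot> x \<cdot> d) \<cdot> v" using ed(1,3) H T by (simp add: f_assoc)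
  also have "\<dots> = u \<cdot> \<psi> (\<phi> (e \<cdot> x \<cdot> d)) \<cdot> v"
    using ed H T by (intro psi_phi_between[symmetric]) auto
  finally have "x = u \<cdot> \<psi> (\<phi> (e \<cdot> x \<cdot> d)) \<cdot> v" .
  then show thesis using that[OF H(1) _ H(2)] ed T by (metis P_T f_closed phi_closed)
qed

theorem rank_upper:
  assumes MI: "MI_dominated P f"
  shows "sg_rank P f \<le>o sg_relrank (carrier W) (\<otimes>) (Units W) +c max_card"
proof -
  obtain A where A: "A \<subseteq> H" "sg_generate f A = H" "|A| \<le>o max_card" using H_generated .
  obtain B where B: "B \<subseteq> carrier W" "sg_generate (\<otimes>) (Units W \<union> B) = carrier W"
    "sg_relrank (carrier W) (\<otimes>) (Units W) = |B|"
    using sg_relrank_attained[of "carrier W" "(\<otimes>)" "Units W"] W.Units_closed by blast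
  let ?C = "\<psi> ` B \<union> A"
  have H_gen: "x \<in> sg_generate f ?C" if "x \<in> H" for x
    using sg_generate_mono[of A ?C] A(2) that by blast
  \<comment> \<open>\<open>\<psi>\<close> turns a word over the units and \<open>B\<close> into a
    word in \<open>P\<close>; its unit letters land in \<open>H\<close>, which \<open>A\<close>
    generates.\<close>
  have psi_gen: "\<psi> w \<in> sg_generate f ?C" if "w \<in> sg_generate (\<otimes>) (Units W \<union> B)" for w
    using that
  proof induction
    case (base w)
    then show ?case using H_gen psi_H by (auto intro: sg_generate.base)
  next
    case (prod v w)
    then show ?case using B(2) by (auto simp: psi_mult intro: sg_generate.prod)
  qed
  have "P \<subseteq> sg_generate f ?C"
  proof
    fix x assume "x \<in> P"
    then show "x \<in> sg_generate f ?C"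
      using MI_dominated_factor[OF MI] H_gen psi_gen B(2) by (metis sg_generate.prod)
  qed
  moreover have C: "?C \<subseteq> P" using A(1) B(1) psi_P by (auto simp: H_def)
  then have "sg_generate f ?C \<subseteq> P" by (rule sg_generate_subset) (rule P_closed)
  ultimately have "sg_generate f ?C = P" by (intro subset_antisym)
  then have "sg_rank P f \<le>o |?C|" using C by (intro sg_rank_le)
  also have "|?C| \<le>o |\<psi> ` B| +c |A|" by (rule Un_csum)
  also have "|\<psi> ` B| +c |A| \<le>o |B| +c max_card"
    using A(3) by (intro csum_mono card_of_image)
  finally show ?thesis using B(3) by simp
qed

end

section \<open>Sandwich semigroups\<close>

context partial_semigroup
begin

definition pm (infixl \<open>\<bullet>\<close> 70) where "x \<bullet> y = the (pmult S x y)"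

lemma pmult_eq:
  assumes "x \<in> hom_set S i j" "y \<in> hom_set S j k"
  shows "pmult S x y = Some (x \<bullet> y)"
  using pmult_defined_iff[of x y] assms by (auto simp: hom_set_def pm_def)

lemma pm_closed:
  assumes "x \<in> hom_set S i j" "y \<in> hom_set S j k"
  shows "x \<bullet> y \<in> hom_set S i k"
  using pmult_eq[OF assms] pmult_closed[of x y] lam_rho_pmult[of x y] assms
  by (auto simp: hom_set_def)

lemma pm_assoc:
  assumes "x \<in> hom_set S i j" "y \<in> hom_set S j k" "z \<in> hom_set S k l"
  shows "x \<bullet> y \<bullet> z = x \<bullet> (y \<bullet> z)"
  using pmult_assoc[OF _ _ _ pmult_eq[OF assms(1,2)] pmult_eq[OF assms(2,3)]] assms
  by (auto simp: hom_set_def pm_def)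

lemma pmult3_eq:
  assumes "x \<in> hom_set S i j" "y \<in> hom_set S j k" "z \<in> hom_set S k l"
  shows "pmult3 S x y z = Some (x \<bullet> y \<bullet> z)"
  using pmult_eq[OF assms(1,2)] pmult_eq[OF pm_closed[OF assms(1,2)] assms(3)]
  by (simp add: pmult3_def)

text \<open>Definedness of \<open>xy\<close> and of \<open>(xy)x\<close> fixes the two ends of
  \<open>y\<close>. This places \<open>b\<close>, and the inverses supplied by regularity in
  \<open>S\<close>, in the correct hom-set.\<close>

lemma pmult3_hom_set:
  assumes "x \<in> hom_set S i j" "y \<in> carrier S" "pmult3 S x y x = Some z"
  shows "y \<in> hom_set S j i"
proof -
  obtain u where u: "pmult S x y = Some u" "pmult S u x = Some z"
    using assms(3) by (auto simp: pmult3_def bind_eq_Some_conv)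
  have x: "x \<in> carrier S" "lam S x = i" "rho S x = j" using assms(1) by (auto simp: hom_set_def)
  have "u \<in> carrier S" "rho S u = rho S y"
    using pmult_closed[OF x(1) assms(2) u(1)] lam_rho_pmult[OF x(1) assms(2) u(1)] by auto
  then show ?thesis
    using pmult_defined_iff[OF x(1) assms(2)] pmult_defined_iff[of u x] u x assms(2)
    by (auto simp: hom_set_def)
qed

end

section \<open>The sandwich semigroup as a semigroup split over \<open>W\<close>\<close>

locale sandwich = partial_semigroup S for S :: "('a, 'i) partial_semigroup_data" +
  fixes i j :: 'i and a b :: 'a
  assumes a_hom [simp]: "a \<in> hom_set S j i"
    and regular: "sandwich_regular S i j a"
    and b_inverse: "b \<in> ps_V S a"
begin

abbreviation "T \<equiv> hom_set S i j"
abbreviation "T' \<equiv> hom_set S j i"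
abbreviation "W \<equiv> sandwich_W S i j a b"

lemma b_hom [simp]: "b \<in> T"
  using b_inverse pmult3_hom_set[OF a_hom, of b a] by (auto simp: ps_V_def)

lemma closed [simp]:
  "x \<in> T \<Longrightarrow> u \<in> T' \<Longrightarrow> x \<bullet> u \<in> hom_set S i i"
  "u \<in> T' \<Longrightarrow> x \<in> T \<Longrightarrow> u \<bullet> x \<in> hom_set S j j"
  "p \<in> hom_set S i i \<Longrightarrow> x \<in> T \<Longrightarrow> p \<bullet> x \<in> T"
  "q \<in> hom_set S j j \<Longrightarrow> u \<in> T' \<Longrightarrow> q \<bullet> u \<in> T'"
  "x \<in> T \<Longrightarrow> q \<in> hom_set S j j \<Longrightarrow> x \<bullet> q \<in> T"
  "u \<in> T' \<Longrightarrow> p \<in> hom_set S i i \<Longrightarrow> u \<bullet> p \<in> T'"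
  by (rule pm_closed; assumption)+

text \<open>These are the typings over the objects \<open>i\<close> and \<open>j\<close> of a triple
  product with first factor in \<open>T\<close> or \<open>T'\<close>. Fixing the objects leaves no
  intermediate object for the simplifier to guess.\<close>

lemma assoc:
  "x \<in> T \<Longrightarrow> u \<in> T' \<Longrightarrow> y \<in> T \<Longrightarrow> x \<bullet> u \<bullet> y = x \<bullet> (u \<bullet> y)"
  "x \<in> T \<Longrightarrow> u \<in> T' \<Longrightarrow> p \<in> hom_set S i i \<Longrightarrow> x \<bullet> u \<bullet> p = x \<bullet> (u \<bullet> p)"
  "x \<in> T \<Longrightarrow> q \<in> hom_set S j j \<Longrightarrow> u \<in> T' \<Longrightarrow> x \<bullet> q \<bullet> u = x \<bullet> (q \<bullet> u)"
  "x \<in> T \<Longrightarrow> q \<in> hom_set S j j \<Longrightarrow> q' \<in> hom_set S j j \<Longrightarrow> x \<bullet> q \<bullet> q' = x \<bullet> (q \<bullet> q')"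
  "u \<in> T' \<Longrightarrow> x \<in> T \<Longrightarrow> v \<in> T' \<Longrightarrow> u \<bullet> x \<bullet> v = u \<bullet> (x \<bullet> v)"
  "u \<in> T' \<Longrightarrow> x \<in> T \<Longrightarrow> q \<in> hom_set S j j \<Longrightarrow> u \<bullet> x \<bullet> q = u \<bullet> (x \<bullet> q)"
  "u \<in> T' \<Longrightarrow> p \<in> hom_set S i i \<Longrightarrow> x \<in> T \<Longrightarrow> u \<bullet> p \<bullet> x = u \<bullet> (p \<bullet> x)"
  "u \<in> T' \<Longrightarrow> p \<in> hom_set S i i \<Longrightarrow> p' \<in> hom_set S i i \<Longrightarrow> u \<bullet> p \<bullet> p' = u \<bullet> (p \<bullet> p')"
  by (rule pm_assoc; assumption)+

lemma aba: "a \<bullet> (b \<bullet> a) = a" and bab: "b \<bullet> (a \<bullet> b) = b"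
  using b_inverse pmult3_eq[OF a_hom b_hom a_hom] pmult3_eq[OF b_hom a_hom b_hom]
  by (simp_all add: ps_V_def assoc)

text \<open>In right-nested products the words \<open>aba\<close> and \<open>bab\<close> are no
  longer subterms; this and \<open>babz\<close> are the variants with a trailing factor.\<close>

lemma abaz: "z \<in> hom_set S i k \<Longrightarrow> a \<bullet> (b \<bullet> (a \<bullet> z)) = a \<bullet> z"
  using pm_assoc[OF a_hom closed(1)[OF b_hom a_hom], of z k] pm_assoc[OF b_hom a_hom, of z k] aba
  by simp

lemma babz: "z \<in> hom_set S j k \<Longrightarrow> b \<bullet> (a \<bullet> (b \<bullet> z)) = b \<bullet> z"
  using pm_assoc[OF b_hom closed(2)[OF a_hom b_hom], of z k] pm_assoc[OF a_hom b_hom, of z k] bab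
  by simp

lemmas normalize = assoc aba bab abaz[where k = i] abaz[where k = j]
  babz[where k = i] babz[where k = j]

lemma sandwich_mult_a: "x \<in> T \<Longrightarrow> y \<in> T \<Longrightarrow> sandwich_mult S a x y = x \<bullet> (a \<bullet> y)"
  using pmult3_eq[of x i j a i y j] by (simp add: sandwich_mult_def assoc)

lemma sandwich_mult_b: "u \<in> T' \<Longrightarrow> v \<in> T' \<Longrightarrow> sandwich_mult S b u v = u \<bullet> (b \<bullet> v)"
  using pmult3_eq[of u j i b j v i] by (simp add: sandwich_mult_def assoc)

lemma phi_eq: "x \<in> T \<Longrightarrow> the (pmult3 S a x a) = a \<bullet> (x \<bullet> a)"
  using pmult3_eq[OF a_hom, of x j a i] by (simp add: assoc)

lemma psi_eq: "u \<in> T' \<Longrightarrow> the (pmult3 S b u b) = b \<bullet> (u \<bullet> b)"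
  using pmult3_eq[OF b_hom, of u i b j] by (simp add: assoc)

lemma carrier_W: "carrier W = (\<lambda>x. a \<bullet> (x \<bullet> a)) ` T"
  by (auto simp: sandwich_W_def sandwich_image_def phi_eq)

lemma carrier_W_cases:
  assumes "w \<in> carrier W"
  obtains x where "x \<in> T" "w = a \<bullet> (x \<bullet> a)"
  using assms by (auto simp: carrier_W)

lemma carrier_W_subset: "w \<in> carrier W \<Longrightarrow> w \<in> T'"
  by (auto simp: carrier_W)

lemma mult_W: "u \<in> carrier W \<Longrightarrow> v \<in> carrier W \<Longrightarrow> u \<otimes>\<^bsub>W\<^esub> v = u \<bullet> (b \<bullet> v)"
  using sandwich_mult_b[of u v] carrier_W_subset by (simp add: sandwich_W_def)

lemma phi_W: "x \<in> T \<Longrightarrow> a \<bullet> (x \<bullet> a) \<in> carrier W"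
  by (auto simp: carrier_W)

lemma phi_mult_W:
  assumes "x \<in> T" "y \<in> T"
  shows "(a \<bullet> (x \<bullet> a)) \<otimes>\<^bsub>W\<^esub> (a \<bullet> (y \<bullet> a)) = a \<bullet> (x \<bullet> (a \<bullet> y) \<bullet> a)"
  using assms by (simp add: mult_W phi_W normalize)

lemma one_W: "\<one>\<^bsub>W\<^esub> = a"
  by (simp add: sandwich_W_def)

lemma a_in_W: "a \<in> carrier W"
  using phi_W[OF b_hom] by (simp add: aba)

lemma monoid_W: "monoid W"
proof
  fix u v w
  assume u: "u \<in> carrier W"
  then obtain x where x: "x \<in> T" "u = a \<bullet> (x \<bullet> a)" by (rule carrier_W_cases)
  show "\<one>\<^bsub>W\<^esub> \<otimes>\<^bsub>W\<^esub> u = u" "u \<otimes>\<^bsub>W\<^esub> \<one>\<^bsub>W\<^esub> = u"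
    using u x by (simp_all add: one_W mult_W a_in_W normalize)
  assume v: "v \<in> carrier W"
  then obtain y where y: "y \<in> T" "v = a \<bullet> (y \<bullet> a)" by (rule carrier_W_cases)
  show "u \<otimes>\<^bsub>W\<^esub> v \<in> carrier W"
    using x y by (simp add: phi_mult_W phi_W)
  assume w: "w \<in> carrier W"
  then obtain z where z: "z \<in> T" "w = a \<bullet> (z \<bullet> a)" by (rule carrier_W_cases)
  show "u \<otimes>\<^bsub>W\<^esub> v \<otimes>\<^bsub>W\<^esub> w = u \<otimes>\<^bsub>W\<^esub> (v \<otimes>\<^bsub>W\<^esub> w)"
    \<comment> \<open>Two passes: reassociating at once would destroy the shape
      \<open>a \<bullet> (x \<bullet> a)\<close> that \<open>phi_mult_W\<close> matches.\<close>
    using x y z by (simp add: phi_mult_W) (simp add: assoc)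
next
  show "\<one>\<^bsub>W\<^esub> \<in> carrier W" by (simp add: one_W a_in_W)
qed

text \<open>An inverse \<open>y\<close> of \<open>w\<close> in \<open>S\<close> lies in
  \<open>T\<close>, and \<open>aya\<close> then serves in \<open>W\<close>: since \<open>w\<close>
  begins and ends with \<open>a\<close>, the factors \<open>b\<close> cancel and leave
  \<open>wyw\<close>.\<close>

lemma W_regular:
  assumes w: "w \<in> carrier W"
  shows "\<exists>v\<in>carrier W. w \<otimes>\<^bsub>W\<^esub> v \<otimes>\<^bsub>W\<^esub> w = w"
proof -
  have w': "w \<in> T'" using w by (rule carrier_W_subset)
  have "w \<in> ps_Reg S"
    using regular w by (auto simp: sandwich_regular_def sandwich_W_def)
  then obtain y where y: "y \<in> carrier S" "pmult3 S w y w = Some w"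
    by (auto simp: ps_Reg_def)
  then have yT: "y \<in> T" using pmult3_hom_set[OF w'] by blast
  have wyw: "w \<bullet> (y \<bullet> w) = w" using y(2) pmult3_eq[OF w' yT w'] w' yT by (simp add: assoc)
  obtain x where x: "x \<in> T" "w = a \<bullet> (x \<bullet> a)" using w by (rule carrier_W_cases)
  have "w \<otimes>\<^bsub>W\<^esub> (a \<bullet> (y \<bullet> a)) \<otimes>\<^bsub>W\<^esub> w = w \<bullet> (y \<bullet> w)"
    using x yT by (simp add: phi_mult_W) (simp add: assoc)
  then show ?thesis using wyw phi_W[OF yT] by auto
qed

sublocale split_over_monoid W T "sandwich_mult S a"
  "\<lambda>x. the (pmult3 S a x a)" "\<lambda>w. the (pmult3 S b w b)"
proof (intro split_over_monoid.intro monoid_W split_over_monoid_axioms.intro)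
  fix x y z c assume x: "x \<in> T"
  show "the (pmult3 S a x a) \<in> carrier W" using x by (simp add: phi_eq phi_W)
  assume y: "y \<in> T"
  show "sandwich_mult S a x y \<in> T" using x y by (simp add: sandwich_mult_a)
  show "the (pmult3 S a (sandwich_mult S a x y) a)
      = the (pmult3 S a x a) \<otimes>\<^bsub>W\<^esub> the (pmult3 S a y a)"
    using x y by (simp add: sandwich_mult_a phi_eq phi_mult_W)
  show "sandwich_mult S a (sandwich_mult S a x y) z = sandwich_mult S a x (sandwich_mult S a y z)"
    if "z \<in> T" using x y that by (simp add: sandwich_mult_a assoc)
  \<comment> \<open>Here \<open>\<psi> (\<phi> c)\<close> is \<open>bacab\<close>, and the
    neighbouring sandwich factors \<open>a\<close> reduce both copies of \<open>aba\<close> to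
    \<open>a\<close>.\<close>
  show "sandwich_mult S a (sandwich_mult S a x (the (pmult3 S b (the (pmult3 S a c a)) b))) y
      = sandwich_mult S a (sandwich_mult S a x c) y" if "c \<in> T"
    using x y that by (simp add: sandwich_mult_a phi_eq psi_eq normalize)
next
  fix v w assume w: "w \<in> carrier W"
  then obtain y where y: "y \<in> T" "w = a \<bullet> (y \<bullet> a)" by (rule carrier_W_cases)
  show "the (pmult3 S b w b) \<in> T" using y by (simp add: psi_eq)
  show "the (pmult3 S a (the (pmult3 S b w b)) a) = w"
    using y by (simp add: psi_eq phi_eq normalize)
  show "\<exists>v\<in>carrier W. w \<otimes>\<^bsub>W\<^esub> v \<otimes>\<^bsub>W\<^esub> w = w" using w by (rule W_regular)
  assume "v \<in> carrier W"
  then obtain x where x: "x \<in> T" "v = a \<bullet> (x \<bullet> a)" by (rule carrier_W_cases)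
  show "the (pmult3 S b (v \<otimes>\<^bsub>W\<^esub> w) b)
      = sandwich_mult S a (the (pmult3 S b v b)) (the (pmult3 S b w b))"
    using x y by (simp add: phi_mult_W psi_eq sandwich_mult_a normalize)
qed

text \<open>As \<open>aba = a\<close> is the identity of \<open>W\<close>, its
  \<open>\<H>\<close>-class is the group of units.\<close>

lemma H_hat_eq: "H_hat S i j a b = H"
proof -
  have "the (pmult3 S a b a) = \<one>\<^bsub>W\<^esub>" by (simp add: phi_eq aba one_W)
  then show ?thesis
    by (auto simp: H_hat_def H_def sandwich_P_def W.green_H_one_iff)
qed

end

theorem theorem3p16:
  fixes S :: "('a, 'i) partial_semigroup_data" and i j :: 'i and a b :: 'a
    and W :: "'a monoid" and G\<^sub>W :: "'a set" and P :: "'a set" and r l :: "'a set rel"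
  assumes "partial_semigroup S"
    and "i \<in> objects S" and "j \<in> objects S"
    and "a \<in> hom_set S j i"
    and "sandwich_regular S i j a"
    and "b \<in> ps_V S a"
    and "P = sandwich_P S i j a"
    and "W = sandwich_W S i j a b"
    and "G\<^sub>W = Units W"
    and "r = |H_hat_mod_R S i j a b|"
    and "l = |H_hat_mod_L S i j a b|"
    and "sg_ideal (carrier W) (mult W) (carrier W - G\<^sub>W)"
  shows "sg_relrank (carrier W) (mult W) G\<^sub>W
             +c card_max r (card_max l (sg_rank G\<^sub>W (mult W)))
           \<le>o sg_rank P (sandwich_mult S a)
         \<and> (MI_dominated P (sandwich_mult S a) \<longrightarrow>
             sg_rank P (sandwich_mult S a)
               =o sg_relrank (carrier W) (mult W) G\<^sub>W
                    +c card_max r (card_max l (sg_rank G\<^sub>W (mult W))))"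
proof -
  interpret sandwich S i j a b
    using assms by (simp add: sandwich_def sandwich_axioms_def)
  have P: "P = sg_Reg (hom_set S i j) (sandwich_mult S a)"
    using assms by (simp add: sandwich_P_def)
  have r: "r = |H_mod_R|" and l: "l = |H_mod_L|"
    using assms by (simp_all add: H_hat_mod_R_def H_hat_mod_L_def H_hat_eq)
  have lower: "sg_relrank (carrier W) (mult W) G\<^sub>W
      +c card_max r (card_max l (sg_rank G\<^sub>W (mult W))) \<le>o sg_rank P (sandwich_mult S a)"
    unfolding P r l using rank_lower assms by simp
  moreover have "sg_rank P (sandwich_mult S a) \<le>o sg_relrank (carrier W) (mult W) G\<^sub>W
      +c card_max r (card_max l (sg_rank G\<^sub>W (mult W)))"
    if "MI_dominated P (sandwich_mult S a)"
    using rank_upper that assms unfolding P r l by simp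
  ultimately show ?thesis by (simp add: ordIso_iff_ordLeq)
qed

end
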